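(* Let $A$ be a finite dimensional commutative $\mathbb{Q}$-algebra with unit element $1_A$. Let $L\in\mathcal{L}(A)$ be a full lattice. Then an order $\Lambda\supset\mathcal{O}(L)$ in $A$ with $\Lambda L\in G(\Lambda)$ (so $\mathcal{O}(\Lambda L)=\Lambda$ and $\Lambda L$ is invertible) exists.
   Context: A full lattice in $A$ is a finitely generated $\mathbb{Z}$-submodule of $A$ which generates $A$ over $\mathbb{Q}$; $\mathcal{L}(A)$ is the set of full lattices. For $L_1,L_2\in\mathcal{L}(A)$, $L_1L_2\in\mathcal{L}(A)$ is the set of finite sums $\sum_i a_ib_i$ with $a_i\in L_1,b_i\in L_2$; this makes $\mathcal{L}(A)$ a commutative semigroup. An order in $A$ is a full lattice $\Lambda$ with $1_A\in\Lambda$ and $\Lambda\Lambda\subset\Lambda$. $\mathcal{O}(L):=\{a\in A\mid aL\subset L\}$ is an order, the order of $L$. A full lattice $L$ is invertible if there are $L',\Lambda'\in\mathcal{L}(A)$ with $LL'=\Lambda'$ and $L\Lambda'=L$; then $\Lambda'$ is unique and equal to $\mathcal{O}(L)$. For an order $\Lambda$, $G(\Lambda)$ is the group of invertible full lattices $L$ with $\mathcal{O}(L)=\Lambda$. *)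

theory Defs
  imports Complex_Main
begin

(* The sort {comm_ring, comm_monoid_mult} is that of commutative rings with unit in which
   0 = 1 is not excluded; comm_ring_1 would rule out the zero algebra. *)

locale fin_dim_comm_rat_algebra = vector_space scale
  for scale :: "rat \<Rightarrow> 'a::{comm_ring, comm_monoid_mult} \<Rightarrow> 'a" +
  assumes scale_mult_left: "scale q x * y = scale q (x * y)"
    and finite_dimensional: "\<exists>B. finite B \<and> span B = UNIV"

(* The Z-module structure underlying the rational scaling. *)
definition int_scale :: "(rat \<Rightarrow> 'a \<Rightarrow> 'a) \<Rightarrow> int \<Rightarrow> 'a \<Rightarrow> 'a" where
  "int_scale scale n x = scale (of_int n) x"

sublocale fin_dim_comm_rat_algebra \<subseteq> Z: module "int_scale scale"
  by unfold_locales (simp_all add: int_scale_def scale_left_distrib scale_right_distrib)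

definition full_lattice ::
  "(rat \<Rightarrow> 'a::{comm_ring, comm_monoid_mult} \<Rightarrow> 'a) \<Rightarrow> 'a set \<Rightarrow> bool" where
  "full_lattice scale L \<longleftrightarrow>
     module.subspace (int_scale scale) L \<and>
     (\<exists>B. finite B \<and> B \<subseteq> L \<and> module.span (int_scale scale) B = L) \<and>
     module.span scale L = UNIV"

definition lattice_mult :: "'a::{comm_ring, comm_monoid_mult} set \<Rightarrow> 'a set \<Rightarrow> 'a set" where
  "lattice_mult L1 L2 =
     {(\<Sum>i<n. a i * b i) | (n::nat) a b. \<forall>i<n. a i \<in> L1 \<and> b i \<in> L2}"

definition is_order ::
  "(rat \<Rightarrow> 'a::{comm_ring, comm_monoid_mult} \<Rightarrow> 'a) \<Rightarrow> 'a set \<Rightarrow> bool" where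
  "is_order scale \<Lambda> \<longleftrightarrow>
     full_lattice scale \<Lambda> \<and> 1 \<in> \<Lambda> \<and> lattice_mult \<Lambda> \<Lambda> \<subseteq> \<Lambda>"

definition order_of :: "'a::{comm_ring, comm_monoid_mult} set \<Rightarrow> 'a set" where
  "order_of L = {a. (\<lambda>x. a * x) ` L \<subseteq> L}"

definition invertible_lattice ::
  "(rat \<Rightarrow> 'a::{comm_ring, comm_monoid_mult} \<Rightarrow> 'a) \<Rightarrow> 'a set \<Rightarrow> bool" where
  "invertible_lattice scale L \<longleftrightarrow>
     full_lattice scale L \<and>
     (\<exists>L' \<Lambda>'. full_lattice scale L' \<and> full_lattice scale \<Lambda>' \<and>
        lattice_mult L L' = \<Lambda>' \<and> lattice_mult L \<Lambda>' = L)"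

(* The underlying set of the group G(\<Lambda>). *)
definition G ::
  "(rat \<Rightarrow> 'a::{comm_ring, comm_monoid_mult} \<Rightarrow> 'a) \<Rightarrow> 'a set \<Rightarrow> 'a set set" where
  "G scale \<Lambda> = {L. invertible_lattice scale L \<and> order_of L = \<Lambda>}"

end

theory Submission
  imports Defs "HOL-Computational_Algebra.Polynomial"
begin

text \<open>
  Some power of \<open>L\<close> is invertible, and its order is the order that is sought. Indeed, if
  \<open>L^(k+1) M = L^k\<close> for some finitely generated \<open>M\<close> and some \<open>k \<ge> 1\<close>, then \<open>L^(k+i) M^i = L^k\<close>
  for all \<open>i\<close>, so \<open>E = L^k M^k\<close> satisfies \<open>E L^k = L^k\<close> and \<open>E E = E\<close>. Nakayama's lemma turns the
  first equation into \<open>1 \<in> E\<close> (\<open>idempotent_contains_one\<close>), whence \<open>E\<close> is an order. Since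
  \<open>L (L^(k-1) M^k) = E\<close>, the lattice \<open>E L\<close> is invertible with order \<open>E\<close>; and an element that
  maps \<open>L\<close> into itself also maps \<open>E\<close> into itself, hence lies in \<open>E\<close> because \<open>1 \<in> E\<close>.

  The module \<open>M\<close> comes from polynomials over \<open>A\<close>. Take \<open>f\<close> in \<open>A[X]\<close> whose coefficients
  generate \<open>L\<close>. If the coefficients of \<open>f g\<close> generate \<open>\<int> 1\<close>, then the content formula of
  Dedekind and Mertens, \<open>c(f)^(m+1) c(g) = c(f)^m c(f g)\<close> for large \<open>m\<close>, is the required equation
  with \<open>M = c(g)\<close> (\<open>dedekind_mertens\<close>, \<open>full_lattice_power_absorbs\<close>).

  Such a \<open>g\<close> exists (\<open>multiple_of_unit_content\<close>): \<open>L\<close> contains a nonzero rational number \<open>\<nu>\<close>, which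
  may be taken as the constant coefficient of \<open>f\<close>. Then \<open>\<nu>\<close> maps \<open>A[X] / f A[X]\<close>, which is
  finitely generated over \<open>\<rat>[X]\<close>, into \<open>X\<close> times itself. So Nakayama's lemma gives
  some \<open>h \<in> 1 + X \<rat>[X]\<close> in \<open>f A[X]\<close>. As a finitely generated subgroup of \<open>\<rat>\<close> is cyclic and
  \<open>h \<noteq> 0\<close>, dividing \<open>h\<close> by a generator of its content makes the content \<open>\<int> 1\<close>.
\<close>

section \<open>Nakayama's lemma\<close>

text \<open>
  Eliminating the generators one at a time takes the place of a determinant: the relation of \<open>z\<close>
  expresses \<open>(1 - c z) z\<close> by the other generators modulo \<open>K\<close>, so multiplying the other
  relations by \<open>1 - c z\<close> removes \<open>z\<close> from them. The factors \<open>1 - x\<close> are multiplied out, as the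
  ring has no unit: the lemma is applied to polynomials over an algebra that may be zero.
\<close>

lemma nakayama:
  fixes I K B :: "'r::comm_ring set"
  assumes "finite B"
    and I: "0 \<in> I" "\<And>x y. x \<in> I \<Longrightarrow> y \<in> I \<Longrightarrow> x + y \<in> I"
      "\<And>x y. x \<in> I \<Longrightarrow> y \<in> I \<Longrightarrow> x - y \<in> I" "\<And>x y. x \<in> I \<Longrightarrow> y \<in> I \<Longrightarrow> x * y \<in> I"
    and K: "\<And>x y. x \<in> K \<Longrightarrow> y \<in> K \<Longrightarrow> x + y \<in> K" "\<And>x y. x \<in> K \<Longrightarrow> y \<in> K \<Longrightarrow> x - y \<in> K"
      "\<And>x y. x \<in> I \<Longrightarrow> y \<in> K \<Longrightarrow> x * y \<in> K"
    and "\<And>b. b \<in> B \<Longrightarrow> \<exists>c. (\<forall>b'\<in>B. c b' \<in> I) \<and> b - (\<Sum>b'\<in>B. c b' * b') \<in> K"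
  shows "\<exists>x\<in>I. \<forall>b\<in>B. b - x * b \<in> K"
  using assms(1) assms(9)
proof (induction B rule: finite_induct)
  case empty
  then show ?case using I(1) by auto
next
  case (insert z B)
  obtain c where cI: "\<forall>b'\<in>insert z B. c b' \<in> I"
    and "z - (\<Sum>b'\<in>insert z B. c b' * b') \<in> K"
    using insert.prems[OF insertI1] by blast
  then have zK: "z - c z * z - (\<Sum>b'\<in>B. c b' * b') \<in> K"
    using insert.hyps by (simp add: algebra_simps)
  have cz: "c z \<in> I" using cI by simp
  have "\<exists>d. (\<forall>b'\<in>B. d b' \<in> I) \<and> b - (\<Sum>b'\<in>B. d b' * b') \<in> K" if b: "b \<in> B" for b
  proof -
    obtain k where kI: "\<forall>b'\<in>insert z B. k b' \<in> I"
      and "b - (\<Sum>b'\<in>insert z B. k b' * b') \<in> K"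
      using insert.prems[OF insertI2[OF b]] by blast
    then have bK: "b - k z * z - (\<Sum>b'\<in>B. k b' * b') \<in> K"
      using insert.hyps by (simp add: algebra_simps)
    define d where "d b' = k b' - c z * k b' + k z * c b' + (if b' = b then c z else 0)" for b'
    have dI: "\<forall>b'\<in>B. d b' \<in> I"
      unfolding d_def using kI cI I by auto
    have dsum: "(\<Sum>b'\<in>B. d b' * b') = (\<Sum>b'\<in>B. k b' * b') - c z * (\<Sum>b'\<in>B. k b' * b')
        + k z * (\<Sum>b'\<in>B. c b' * b') + c z * b"
    proof -
      have "(\<Sum>b'\<in>B. (if b' = b then c z else 0) * b') = (\<Sum>b'\<in>B. if b' = b then c z * b' else 0)"
        by (rule sum.cong) auto
      also have "\<dots> = c z * b" using b insert.hyps(1) by simp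
      finally show ?thesis
        by (simp add: d_def ring_distribs sum.distrib sum_subtractf sum_distrib_left mult.assoc)
    qed
    \<comment> \<open>\<open>1 - c z\<close> times the relation of \<open>b\<close>, with \<open>(1 - c z) z\<close> replaced by the relation of \<open>z\<close>\<close>
    have "b - (\<Sum>b'\<in>B. d b' * b') =
        (b - k z * z - (\<Sum>b'\<in>B. k b' * b')) - c z * (b - k z * z - (\<Sum>b'\<in>B. k b' * b'))
        + k z * (z - c z * z - (\<Sum>b'\<in>B. c b' * b'))"
      unfolding dsum by (simp add: algebra_simps)
    also have "\<dots> \<in> K" using bK zK K cz kI by simp
    finally show ?thesis using dI by blast
  qed
  then obtain x where x: "x \<in> I" "\<forall>b\<in>B. b - x * b \<in> K"
    using insert.IH by blast
  \<comment> \<open>chosen such that \<open>1 - y = (1 - x) (1 - c z)\<close>\<close>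
  define y where "y = x + c z - x * c z"
  have yI: "y \<in> I" unfolding y_def using x cz I by simp
  have *: "b - y * b = (b - x * b) - c z * (b - x * b)" for b
    unfolding y_def by (simp add: algebra_simps)
  have "b - y * b \<in> K" if "b \<in> B" for b
    unfolding * using x cz K that by simp
  moreover have "z - y * z \<in> K"
  proof -
    have sK: "(\<Sum>b'\<in>B. c b' * (b' - x * b')) \<in> K"
    proof -
      have "0 \<in> K" using zK K(2)[OF zK zK] by simp
      then show ?thesis using cI x K by (induction B rule: infinite_finite_induct) auto
    qed
    have "z - y * z = (z - c z * z - (\<Sum>b'\<in>B. c b' * b')) - x * (z - c z * z - (\<Sum>b'\<in>B. c b' * b'))
        + (\<Sum>b'\<in>B. c b' * (b' - x * b'))"
      unfolding y_def by (simp add: algebra_simps sum_subtractf sum_distrib_left)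
    also have "\<dots> \<in> K" using zK sK K x by simp
    finally show ?thesis .
  qed
  ultimately show ?case using yI by blast
qed

section \<open>Products and powers of subgroups\<close>

context fin_dim_comm_rat_algebra
begin

lemma scale_mult_right: "x * scale q y = scale q (x * y)"
  using scale_mult_left[of q y x] by (simp add: mult.commute)

lemma int_scale_mult_left: "int_scale scale n x * y = int_scale scale n (x * y)"
  by (simp add: int_scale_def scale_mult_left)

text \<open>
  For subgroups this is \<open>lattice_mult\<close> (see \<open>lattice_mult_eq_prod\<close>). Taking the span makes the
  product of arbitrary sets a subgroup that depends only on the subgroups they generate.
\<close>

definition prod_module :: "'a set \<Rightarrow> 'a set \<Rightarrow> 'a set"  (infixl \<open>\<odot>\<close> 70) where
  "P \<odot> Q = Z.span {p * q | p q. p \<in> P \<and> q \<in> Q}"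

lemma subspace_prod [simp]: "Z.subspace (P \<odot> Q)"
  by (simp add: prod_module_def)

lemma prodI: "p \<in> P \<Longrightarrow> q \<in> Q \<Longrightarrow> p * q \<in> P \<odot> Q"
  unfolding prod_module_def by (rule Z.span_base) blast

lemma prod_least: "Z.subspace T \<Longrightarrow> (\<And>p q. p \<in> P \<Longrightarrow> q \<in> Q \<Longrightarrow> p * q \<in> T) \<Longrightarrow> P \<odot> Q \<subseteq> T"
  unfolding prod_module_def by (rule Z.span_minimal) auto

lemma prod_module_mono: "P \<subseteq> P' \<Longrightarrow> Q \<subseteq> Q' \<Longrightarrow> P \<odot> Q \<subseteq> P' \<odot> Q'"
  by (rule prod_least) (auto intro: prodI)

lemma prod_commute: "P \<odot> Q = Q \<odot> P"
  unfolding prod_module_def by (rule arg_cong[where f = Z.span]) (auto, (metis mult.commute)+)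

text \<open>
  Residuals reduce a claim about all elements of a generated subgroup to its generators.
\<close>

lemma subspace_residual: "Z.subspace T \<Longrightarrow> Z.subspace {x. \<forall>q\<in>Q. x * q \<in> T}"
  by (rule Z.subspaceI)
    (auto simp: distrib_right int_scale_mult_left Z.subspace_0 Z.subspace_add Z.subspace_scale)

lemma span_prod_least:
  assumes "Z.subspace T" "\<And>p q. p \<in> P \<Longrightarrow> q \<in> Q \<Longrightarrow> p * q \<in> T"
    and "x \<in> Z.span P" "y \<in> Z.span Q"
  shows "x * y \<in> T"
proof -
  have *: "Z.span P \<subseteq> {x. \<forall>q\<in>Q. x * q \<in> T}"
    using assms by (intro Z.span_minimal subspace_residual) auto
  have "Q \<subseteq> {y. \<forall>x\<in>Z.span P. y * x \<in> T}"
  proof clarify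
    fix y x assume "y \<in> Q" "x \<in> Z.span P"
    then have "x * y \<in> T" using * by blast
    then show "y * x \<in> T" by (simp add: mult.commute)
  qed
  then have "Z.span Q \<subseteq> {y. \<forall>x\<in>Z.span P. y * x \<in> T}"
    using assms(1) by (intro Z.span_minimal subspace_residual)
  then show ?thesis using assms(3,4) by (auto simp: mult.commute)
qed

lemma prod_span: "Z.span P \<odot> Z.span Q = P \<odot> Q"
proof
  show "Z.span P \<odot> Z.span Q \<subseteq> P \<odot> Q"
    by (rule prod_least[OF subspace_prod]) (rule span_prod_least[OF subspace_prod prodI])
  show "P \<odot> Q \<subseteq> Z.span P \<odot> Z.span Q"
    by (intro prod_module_mono Z.span_superset)
qed

lemma prod_span_left: "Z.span P \<odot> Q = P \<odot> Q"
  by (metis prod_span Z.span_span)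

lemma prod_span_right: "P \<odot> Z.span Q = P \<odot> Q"
  by (metis prod_span Z.span_span)

lemma prod_assoc: "P \<odot> Q \<odot> R = P \<odot> (Q \<odot> R)"
proof -
  let ?PQ = "{p * q | p q. p \<in> P \<and> q \<in> Q}" and ?QR = "{p * q | p q. p \<in> Q \<and> q \<in> R}"
  have "P \<odot> Q \<odot> R = ?PQ \<odot> R"
    unfolding prod_module_def[of P Q] by (rule prod_span_left)
  also have "\<dots> = P \<odot> ?QR"
    unfolding prod_module_def by (rule arg_cong[where f = Z.span]) (auto, (metis mult.assoc)+)
  also have "\<dots> = P \<odot> (Q \<odot> R)"
    unfolding prod_module_def[of Q R] by (rule prod_span_right[symmetric])
  finally show ?thesis .
qed

lemma prod_left_commute: "P \<odot> (Q \<odot> R) = Q \<odot> (P \<odot> R)"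
  by (metis prod_assoc prod_commute)

lemmas prod_ac = prod_assoc prod_commute prod_left_commute

lemma prod_one: "Z.subspace P \<Longrightarrow> Z.span {1} \<odot> P = P"
proof -
  assume P: "Z.subspace P"
  have "Z.span {1} \<odot> P = {1} \<odot> P" by (rule prod_span_left)
  also have "{1} \<odot> P = Z.span P" unfolding prod_module_def by simp
  also have "\<dots> = P" using P by (simp add: Z.span_eq_iff[THEN iffD2])
  finally show ?thesis .
qed

lemma lattice_mult_eq_prod:
  assumes "Z.subspace P"
  shows "lattice_mult P Q = P \<odot> Q"
proof
  show "lattice_mult P Q \<subseteq> P \<odot> Q"
    unfolding lattice_mult_def by (auto intro!: Z.subspace_sum[OF subspace_prod] prodI)
  have sub: "Z.subspace (lattice_mult P Q)"
  proof (rule Z.subspaceI)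
    show "0 \<in> lattice_mult P Q"
      unfolding lattice_mult_def by (rule CollectI, rule exI[of _ 0]) simp
  next
    fix x y assume "x \<in> lattice_mult P Q" "y \<in> lattice_mult P Q"
    then obtain n a b m c d where
      x: "x = (\<Sum>i<(n::nat). a i * b i)" "\<forall>i<n. a i \<in> P \<and> b i \<in> Q" and
      y: "y = (\<Sum>i<(m::nat). c i * d i)" "\<forall>i<m. c i \<in> P \<and> d i \<in> Q"
      unfolding lattice_mult_def by blast
    let ?a = "\<lambda>i. if i < n then a i else c (i - n)" and ?b = "\<lambda>i. if i < n then b i else d (i - n)"
    have "x + y = (\<Sum>i<n + m. ?a i * ?b i)"
    proof -
      have "(\<Sum>i<n + m. h i) = (\<Sum>i<n. h i) + (\<Sum>i<m. h (n + i))" for h :: "nat \<Rightarrow> 'a"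
        by (induction m) (simp_all add: add.assoc)
      then show ?thesis unfolding x y by simp
    qed
    moreover have "\<forall>i<n + m. ?a i \<in> P \<and> ?b i \<in> Q" using x y by auto
    ultimately show "x + y \<in> lattice_mult P Q"
      unfolding lattice_mult_def
      by (intro CollectI exI[of _ "n + m"] exI[of _ ?a] exI[of _ ?b] conjI)
  next
    fix k x assume "x \<in> lattice_mult P Q"
    then obtain n a b where
      x: "x = (\<Sum>i<(n::nat). a i * b i)" "\<forall>i<n. a i \<in> P \<and> b i \<in> Q"
      unfolding lattice_mult_def by blast
    then have "int_scale scale k x = (\<Sum>i<n. int_scale scale k (a i) * b i)"
      by (simp add: Z.scale_sum_right int_scale_mult_left)
    moreover have "\<forall>i<n. int_scale scale k (a i) \<in> P \<and> b i \<in> Q"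
      using x assms by (auto intro: Z.subspace_scale)
    ultimately show "int_scale scale k x \<in> lattice_mult P Q"
      unfolding lattice_mult_def
      by (intro CollectI exI[of _ n] exI[of _ "\<lambda>i. int_scale scale k (a i)"] exI[of _ b] conjI)
  qed
  show "P \<odot> Q \<subseteq> lattice_mult P Q"
  proof (rule prod_least[OF sub])
    fix p q assume "p \<in> P" "q \<in> Q"
    then show "p * q \<in> lattice_mult P Q"
      unfolding lattice_mult_def
      by (intro CollectI exI[of _ "1 :: nat"] exI[of _ "\<lambda>_. p"] exI[of _ "\<lambda>_. q"]) simp
  qed
qed

primrec power_module :: "'a set \<Rightarrow> nat \<Rightarrow> 'a set" where
  "power_module P 0 = Z.span {1}"
| "power_module P (Suc k) = P \<odot> power_module P k"

lemma subspace_power [simp]: "Z.subspace (power_module P k)"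
  by (cases k) auto

lemma power_mono_module: "P \<subseteq> Q \<Longrightarrow> power_module P k \<subseteq> power_module Q k"
  by (induction k) (simp_all add: prod_module_mono)

text \<open>
  A product of \<open>k + 1\<close> generators from \<open>F' \<union> {a}\<close> either avoids \<open>a\<close> or has a factor \<open>a\<close>.
\<close>

lemma power_insert:
  assumes F: "F \<subseteq> Z.span (insert a F')" and F': "F' \<subseteq> F"
  shows "power_module F (Suc k) \<subseteq> Z.span (power_module F' (Suc k) \<union> {a} \<odot> power_module F k)"
    (is "_ \<subseteq> Z.span (?A k \<union> ?B k)")
proof (induction k)
  case 0
  have "F \<odot> Z.span {1} \<subseteq> Z.span (insert a F') \<odot> Z.span {1}"
    using F by (intro prod_module_mono) auto
  also have "\<dots> = insert a F' \<odot> {1}" by (rule prod_span)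
  also have "\<dots> \<subseteq> Z.span (?A 0 \<union> ?B 0)"
  proof (rule prod_least[OF Z.subspace_span], rule Z.span_base)
    fix p q :: 'a assume pq: "p \<in> insert a F'" "q \<in> {1}"
    then have "q \<in> Z.span {1}" by (auto intro: Z.span_base)
    with pq(1) show "p * q \<in> ?A 0 \<union> ?B 0" by (auto intro: prodI)
  qed
  finally show ?case by simp
next
  case (Suc k)
  have "x * y \<in> Z.span (?A (Suc k) \<union> ?B (Suc k))"
    if x: "x \<in> insert a F'" and y: "y \<in> power_module F (Suc k)" for x y
  proof (cases "x = a")
    case True
    then have "x * y \<in> ?B (Suc k)" using y by (intro prodI) auto
    then show ?thesis by (intro Z.span_base) simp
  next
    case False
    then have x: "x \<in> F'" using x by simp
    have "y \<in> Z.span (?A k \<union> ?B k)" using y Suc.IH by blast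
    moreover have "x * w \<in> Z.span (?A (Suc k) \<union> ?B (Suc k))" if "w \<in> ?A k \<union> ?B k" for w
      using that
    proof
      assume "w \<in> ?A k"
      then have "x * w \<in> ?A (Suc k)" using x by (simp add: prodI)
      then show ?thesis by (intro Z.span_base) simp
    next
      assume "w \<in> ?B k"
      then have "x * w \<in> F \<odot> ({a} \<odot> power_module F k)" using x F' by (auto intro: prodI)
      also have "\<dots> = ?B (Suc k)" by (simp add: prod_left_commute)
      finally show ?thesis by (intro Z.span_base) simp
    qed
    moreover have "x \<in> Z.span {x}" by (rule Z.span_base) simp
    ultimately show ?thesis
      using span_prod_least[OF Z.subspace_span, of "{x}" "?A k \<union> ?B k"] by blast
  qed
  then have "insert a F' \<odot> power_module F (Suc k) \<subseteq> Z.span (?A (Suc k) \<union> ?B (Suc k))"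
    by (intro prod_least) auto
  moreover have "power_module F (Suc (Suc k)) \<subseteq> Z.span (insert a F') \<odot> Z.span (power_module F (Suc k))"
    unfolding power_module.simps(2)[of F "Suc k"] using F by (intro prod_module_mono Z.span_superset)
  ultimately show ?case unfolding prod_span by blast
qed

section \<open>The content formula of Dedekind and Mertens\<close>

definition content_module :: "'a poly \<Rightarrow> 'a set" where
  "content_module f = Z.span (range (coeff f))"

lemma coeff_in_content [simp]: "coeff f i \<in> content_module f"
  unfolding content_module_def by (rule Z.span_base) simp

lemma subspace_content [simp]: "Z.subspace (content_module f)"
  by (simp add: content_module_def)

lemma content_least: "Z.subspace T \<Longrightarrow> (\<And>i. coeff f i \<in> T) \<Longrightarrow> content_module f \<subseteq> T"
  unfolding content_module_def by (rule Z.span_minimal) auto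

lemma content_mult: "content_module (f * g) \<subseteq> content_module f \<odot> content_module g"
  by (rule content_least) (auto simp: coeff_mult intro!: Z.subspace_sum prodI)

lemma content_truncate:
  "content_module (f - monom (coeff f n) n) \<subseteq> content_module f"
  "content_module f \<subseteq> Z.span (insert (coeff f n) (content_module (f - monom (coeff f n) n)))"
proof -
  let ?f' = "f - monom (coeff f n) n"
  have c: "coeff ?f' i = (if i = n then 0 else coeff f i)" for i by simp
  show "content_module ?f' \<subseteq> content_module f"
    by (rule content_least) (auto simp: Z.subspace_0)
  show "content_module f \<subseteq> Z.span (insert (coeff f n) (content_module ?f'))"
  proof (rule content_least[OF Z.subspace_span], rule Z.span_base)
    fix i show "coeff f i \<in> insert (coeff f n) (content_module ?f')"
      using coeff_in_content[of ?f' i] unfolding c by (cases "i = n") auto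
  qed
qed

text \<open>
  Induction on the length of \<open>g\<close> and, within it, on the length of \<open>f\<close>. Let \<open>a\<close> and \<open>b\<close> be the top
  coefficients, so that \<open>a b\<close> is one of \<open>f g\<close>. Removing the top term of \<open>g\<close> from \<open>a g\<close> changes
  \<open>f (a g)\<close> only by \<open>a b X^l f\<close>, so the shorter \<open>g\<close> settles all products with a factor \<open>a\<close>.
  The products without a factor \<open>a\<close> belong to \<open>f\<close> without its top term, whose product with \<open>g\<close>
  differs from \<open>f g\<close> by terms with a factor \<open>a\<close>, which are settled already.
\<close>

lemma dedekind_mertens:
  assumes "\<And>i. i \<ge> l \<Longrightarrow> coeff g i = 0"
  shows "power_module (content_module f) (Suc l) \<odot> content_module g
    \<subseteq> power_module (content_module f) l \<odot> content_module (f * g)"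
  using assms
proof (induction l arbitrary: f g)
  case 0
  then have "content_module g \<subseteq> {0}" by (intro content_least) auto
  then show ?case by (intro prod_least) (auto simp: Z.subspace_0)
next
  case (Suc l)
  have "\<exists>n. \<forall>i\<ge>n. coeff f i = 0" by (metis coeff_eq_0 Suc_le_eq)
  then obtain n where "\<forall>i\<ge>n. coeff f i = 0" ..
  then show ?case
  proof (induction n arbitrary: f)
    case 0
    then have "content_module f \<subseteq> {0}" by (intro content_least) auto
    then have "power_module (content_module f) (Suc (Suc l)) \<subseteq> {0}"
      unfolding power_module.simps(2)[of _ "Suc l"] by (intro prod_least) auto
    then show ?case by (intro prod_least) (auto simp: Z.subspace_0)
  next
    case (Suc n)
    define a b where "a = coeff f n" and "b = coeff g l"
    define f' g' where "f' = f - monom a n" and "g' = g - monom b l"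
    define F G H where "F = content_module f" and "G = content_module g"
      and "H = content_module (f * g)"
    define T where "T = power_module F (Suc l) \<odot> H"
    have subT: "Z.subspace T" by (simp add: T_def)
    have aF: "a \<in> F" by (simp add: a_def F_def)
    have ab: "a * b \<in> H"
    proof -
      have "coeff (f * g) (n + l) = a * b"
        unfolding coeff_mult a_def b_def
      proof (subst sum.remove[of _ n])
        have "coeff f i * coeff g (n + l - i) = 0" if "i \<noteq> n" for i
          using Suc.prems \<open>\<And>i. Suc l \<le> i \<Longrightarrow> coeff g i = 0\<close> that
          by (cases "i < n") auto
        then show "coeff f n * coeff g (n + l - n)
            + (\<Sum>i\<in>{..n + l} - {n}. coeff f i * coeff g (n + l - i)) = coeff f n * coeff g l"
          by simp
      qed auto
      then show ?thesis unfolding H_def by (metis coeff_in_content)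
    qed
    \<comment> \<open>products with a factor \<open>a\<close>, by the outer induction hypothesis for \<open>a (g - b X^l)\<close>\<close>
    have step: "a * (x * y) \<in> T" if "x \<in> power_module F (Suc l)" "y \<in> G" for x y
    proof -
      have "coeff (smult a g') i = 0" if "i \<ge> l" for i
        using Suc.prems \<open>\<And>i. Suc l \<le> i \<Longrightarrow> coeff g i = 0\<close> that
        by (cases "i = l") (auto simp: g'_def b_def)
      then have IH: "power_module F (Suc l) \<odot> content_module (smult a g')
          \<subseteq> power_module F l \<odot> content_module (f * smult a g')"
        unfolding F_def by (rule \<open>\<And>g f. (\<And>i. l \<le> i \<Longrightarrow> coeff g i = 0) \<Longrightarrow>
            power_module (content_module f) (Suc l) \<odot> content_module g
            \<subseteq> power_module (content_module f) l \<odot> content_module (f * g)\<close>)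
      have "content_module (f * smult a g') \<subseteq> F \<odot> H"
      proof (rule content_least)
        fix i
        have *: "f * smult a g' = smult a (f * g) - monom (a * b) l * f"
          unfolding g'_def by (simp add: algebra_simps smult_diff_right smult_monom)
        have "a * coeff (f * g) i \<in> F \<odot> H" by (rule prodI[OF aF]) (simp add: H_def)
        moreover have "coeff (monom (a * b) l * f) i \<in> F \<odot> H"
        proof -
          have "coeff f (i - l) * (a * b) \<in> F \<odot> H" using ab by (intro prodI) (simp_all add: F_def)
          then have "a * b * coeff f (i - l) \<in> F \<odot> H" by (simp only: mult.commute)
          then show ?thesis by (simp add: coeff_monom_mult Z.subspace_0)
        qed
        ultimately show "coeff (f * smult a g') i \<in> F \<odot> H"
          unfolding * by (simp add: Z.subspace_diff)
      qed simp
      then have "power_module F l \<odot> content_module (f * smult a g') \<subseteq> power_module F l \<odot> (F \<odot> H)"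
        by (intro prod_module_mono) auto
      also have "\<dots> = T" unfolding T_def by (simp add: prod_ac)
      finally have *: "x * z \<in> T" if "z \<in> content_module (smult a g')" for z
        using IH that \<open>x \<in> power_module F (Suc l)\<close> by (meson prodI subsetD)
      have R: "Z.subspace {z. \<forall>q\<in>{x * a}. z * q \<in> T}" by (rule subspace_residual[OF subT])
      have g'R: "content_module g' \<subseteq> {z. \<forall>q\<in>{x * a}. z * q \<in> T}"
      proof (rule content_least[OF R])
        fix i
        show "coeff g' i \<in> {z. \<forall>q\<in>{x * a}. z * q \<in> T}"
          using *[OF coeff_in_content[of "smult a g'" i]] by (simp add: mult_ac)
      qed
      have bR: "b \<in> {z. \<forall>q\<in>{x * a}. z * q \<in> T}"
        using prodI[OF \<open>x \<in> power_module F (Suc l)\<close> ab] by (simp add: T_def mult_ac)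
      have "G \<subseteq> Z.span (insert b (content_module g'))"
        unfolding G_def b_def g'_def by (rule content_truncate)
      also have "\<dots> \<subseteq> {z. \<forall>q\<in>{x * a}. z * q \<in> T}"
        using g'R bR by (intro Z.span_minimal R) auto
      finally show ?thesis using \<open>y \<in> G\<close> by (auto simp: mult_ac)
    qed
    \<comment> \<open>products without a factor \<open>a\<close>, by the inner induction hypothesis for \<open>f - a X^n\<close>\<close>
    have "\<forall>i\<ge>n. coeff f' i = 0"
      using Suc.prems by (auto simp: f'_def a_def Suc_le_eq)
    then have IH: "power_module (content_module f') (Suc (Suc l)) \<odot> G
        \<subseteq> power_module (content_module f') (Suc l) \<odot> content_module (f' * g)"
      unfolding G_def by (rule Suc.IH)
    have f'F: "content_module f' \<subseteq> F" unfolding f'_def a_def F_def by (rule content_truncate)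
    have "x * y \<in> T" if x: "x \<in> power_module F (Suc l)" and "y \<in> content_module (f' * g)" for x y
    proof -
      have "content_module (f' * g) \<subseteq> {y. \<forall>q\<in>{x}. y * q \<in> T}"
      proof (rule content_least[OF subspace_residual[OF subT]])
        fix i
        have *: "coeff (f' * g) i = coeff (f * g) i - (if i < n then 0 else a * coeff g (i - n))"
          by (simp add: f'_def left_diff_distrib coeff_monom_mult)
        have "x * coeff (f * g) i \<in> T" unfolding T_def by (rule prodI[OF x]) (simp add: H_def)
        moreover have "x * (if i < n then 0 else a * coeff g (i - n)) \<in> T"
          using step[OF x, of "coeff g (i - n)"] subT
          by (simp add: G_def mult_ac Z.subspace_0)
        ultimately show "coeff (f' * g) i \<in> {y. \<forall>q\<in>{x}. y * q \<in> T}"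
          unfolding * using Z.subspace_diff[OF subT] by (simp add: right_diff_distrib mult.commute)
      qed
      then show ?thesis using that by (auto simp: mult.commute)
    qed
    then have "power_module F (Suc l) \<odot> content_module (f' * g) \<subseteq> T"
      by (rule prod_least[OF subT])
    then have f'T: "power_module (content_module f') (Suc (Suc l)) \<odot> G \<subseteq> T"
      using IH prod_module_mono[OF power_mono_module[OF f'F, of "Suc l"] order_refl] by blast
    have "F \<subseteq> Z.span (insert a (content_module f'))"
      unfolding f'_def a_def F_def by (rule content_truncate)
    from power_insert[OF this f'F, of "Suc l"]
    have "power_module F (Suc (Suc l)) \<odot> G
      \<subseteq> Z.span (power_module (content_module f') (Suc (Suc l)) \<union> {a} \<odot> power_module F (Suc l)) \<odot> Z.span G"
      by (intro prod_module_mono Z.span_superset)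
    also have "\<dots> \<subseteq> T"
      unfolding prod_span
    proof (rule prod_least[OF subT])
      fix x y
      assume x: "x \<in> power_module (content_module f') (Suc (Suc l)) \<union> {a} \<odot> power_module F (Suc l)"
        and y: "y \<in> G"
      from x show "x * y \<in> T"
      proof
        assume "x \<in> power_module (content_module f') (Suc (Suc l))"
        then show ?thesis using f'T y by (meson prodI subsetD)
      next
        assume x: "x \<in> {a} \<odot> power_module F (Suc l)"
        have "{a} \<odot> power_module F (Suc l) \<subseteq> {x. \<forall>q\<in>G. x * q \<in> T}"
          using step by (intro prod_least subspace_residual subT) (auto simp: mult_ac)
        then show ?thesis using x y by blast
      qed
    qed
    finally show ?case unfolding T_def F_def G_def H_def .
  qed
qed

end

section \<open>Scaling a polynomial to rational content\<close>

lemma bezout_rat: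
  fixes x y :: rat
  shows "\<exists>m n a b. x = of_int a * (of_int m * x + of_int n * y) \<and>
    y = of_int b * (of_int m * x + of_int n * y)"
proof -
  obtain a p where x: "x = of_int a / of_int p" "p > 0"
    using quotient_of_div[OF prod.collapse[symmetric]] quotient_of_denom_pos' by metis
  obtain b q where y: "y = of_int b / of_int q" "q > 0"
    using quotient_of_div[OF prod.collapse[symmetric]] quotient_of_denom_pos' by metis
  obtain m n where mn: "m * (a * q) + n * (b * p) = gcd (a * q) (b * p)"
    using bezout_int by blast
  have "rat_of_int (m * (a * q) + n * (b * p)) / of_int (p * q) = of_int m * x + of_int n * y"
    unfolding x(1) y(1) using x(2) y(2) by (simp add: field_simps)
  then have "rat_of_int (gcd (a * q) (b * p)) / of_int (p * q) = of_int m * x + of_int n * y"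
    unfolding mn .
  moreover obtain k where "a * q = gcd (a * q) (b * p) * k" using gcd_dvd1 by blast
  moreover obtain l where "b * p = gcd (a * q) (b * p) * l" using gcd_dvd2 by blast
  moreover have "x = of_int (a * q) / of_int (p * q)" "y = of_int (b * p) / of_int (p * q)"
    using x y by simp_all
  ultimately have "x = of_int k * (of_int m * x + of_int n * y)"
    "y = of_int l * (of_int m * x + of_int n * y)"
    by (metis mult.commute of_int_mult times_divide_eq_right)+
  then show ?thesis by blast
qed

lemma finite_rat_subgroup_cyclic:
  fixes S :: "rat set"
  assumes "finite S"
  shows "\<exists>c u. c = (\<Sum>x\<in>S. of_int (u x) * x) \<and> (\<forall>x\<in>S. \<exists>z. x = of_int z * c)"
  using assms
proof (induction S)
  case empty
  then show ?case by simp
next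
  case (insert y S)
  then obtain c u where c: "c = (\<Sum>x\<in>S. of_int (u x) * x)" "\<forall>x\<in>S. \<exists>z. x = of_int z * c"
    by blast
  obtain m n a b where d: "y = of_int a * (of_int m * y + of_int n * c)"
    "c = of_int b * (of_int m * y + of_int n * c)"
    using bezout_rat by blast
  define d where "d = of_int m * y + of_int n * c"
  define v where "v x = (if x = y then m else n * u x)" for x
  have "(\<Sum>x\<in>insert y S. of_int (v x) * x) = of_int m * y + (\<Sum>x\<in>S. of_int (v x) * x)"
    using insert.hyps by (simp add: v_def)
  also have "(\<Sum>x\<in>S. of_int (v x) * x) = (\<Sum>x\<in>S. of_int n * (of_int (u x) * x))"
    using insert.hyps by (intro sum.cong) (auto simp: v_def)
  also have "\<dots> = of_int n * c" unfolding c(1) by (simp add: sum_distrib_left)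
  finally have "d = (\<Sum>x\<in>insert y S. of_int (v x) * x)" by (simp add: d_def)
  moreover have "\<exists>z. x = of_int z * d" if "x \<in> insert y S" for x
    using that
  proof
    assume "x = y"
    then show ?thesis using d(1) d_def by blast
  next
    assume "x \<in> S"
    then obtain z where "x = of_int z * c" using c(2) by blast
    then have "x = of_int (z * b) * d" using d(2) d_def by (metis mult.assoc of_int_mult)
    then show ?thesis by blast
  qed
  ultimately show ?case by blast
qed

context fin_dim_comm_rat_algebra
begin

lemma coeff_mult_const: "coeff (p * [:b:]) k = coeff p k * b" for b :: 'a
  by (simp add: mult.commute)

text \<open>
  Nakayama's lemma for \<open>A[X]\<close> modulo \<open>F A[X]\<close>, generated over \<open>\<rat>[X]\<close> by the constants in \<open>B\<close>,
  with \<open>I = X \<rat>[X]\<close>: modulo \<open>F\<close>, each \<open>b\<close> is \<open>- X f b / \<nu>\<close>. It yields \<open>x \<in> X \<rat>[X]\<close> for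
  which \<open>1 - x\<close> kills the quotient, that is, \<open>1 - x\<close> is a multiple of \<open>F\<close>.
\<close>

lemma rational_multiple:
  assumes "finite B" "span B = UNIV" "\<nu> \<noteq> 0"
  shows "\<exists>g q. q 0 = 1 \<and> (\<forall>k. coeff (pCons (scale \<nu> 1) f * g) k = scale (q k) 1)"
proof -
  define F where "F = pCons (scale \<nu> 1) f"
  define R where "R = range (\<lambda>q. scale q 1)"
  define I where "I = {x. coeff x 0 = 0 \<and> (\<forall>k. coeff x k \<in> R)}"
  define K where "K = range (\<lambda>g. F * g)"
  have R0: "0 \<in> R" unfolding R_def by (rule image_eqI[of _ _ 0]) simp_all
  have Radd: "x + y \<in> R" if "x \<in> R" "y \<in> R" for x y
    using that unfolding R_def by (auto simp flip: scale_left_distrib)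
  have Rdiff: "x - y \<in> R" if "x \<in> R" "y \<in> R" for x y
    using that unfolding R_def by (auto simp flip: scale_left_diff_distrib)
  have Rmult: "x * y \<in> R" if "x \<in> R" "y \<in> R" for x y
    using that unfolding R_def by (auto simp: scale_mult_left)
  have Rsum: "sum h A \<in> R" if "\<And>i. i \<in> A \<Longrightarrow> h i \<in> R" for h :: "nat \<Rightarrow> 'a" and A
    using that by (induction A rule: infinite_finite_induct) (auto intro: R0 Radd)
  have Rscale: "scale q 1 \<in> R" for q unfolding R_def by blast
  have comb: "\<exists>r. x = (\<Sum>b\<in>B. scale (r b) b)" for x
    using span_finite[OF assms(1)] assms(2) by auto
  have expand: "\<exists>y. (\<forall>b\<in>B. \<forall>k. coeff (y b) k \<in> R) \<and> u = (\<Sum>b\<in>B. y b * [:b:])" for u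
  proof (induction u)
    case 0
    show ?case by (rule exI[of _ "\<lambda>_. 0"]) (simp add: R0)
  next
    case (pCons a u)
    obtain y where y: "\<forall>b\<in>B. \<forall>k. coeff (y b) k \<in> R" "u = (\<Sum>b\<in>B. y b * [:b:])"
      using pCons.IH by blast
    obtain r where r: "a = (\<Sum>b\<in>B. scale (r b) b)" using comb by blast
    have "pCons a u = (\<Sum>b\<in>B. pCons (scale (r b) 1) (y b) * [:b:])"
      unfolding r y(2)
    proof (rule poly_eqI)
      fix k
      show "coeff (pCons (\<Sum>b\<in>B. scale (r b) b) (\<Sum>b\<in>B. y b * [:b:])) k
          = coeff (\<Sum>b\<in>B. pCons (scale (r b) 1) (y b) * [:b:]) k"
        by (cases k) (simp_all add: coeff_sum coeff_mult_const scale_mult_left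
            del: mult_pCons_left mult_pCons_right)
    qed
    moreover have "\<forall>b\<in>B. \<forall>k. coeff (pCons (scale (r b) 1) (y b)) k \<in> R"
      using y(1) Rscale by (auto simp: coeff_pCons split: nat.split)
    ultimately show ?case
      by (intro exI[of _ "\<lambda>b. pCons (scale (r b) 1) (y b)"] conjI)
  qed
  let ?B = "(\<lambda>b. [:b:]) ` B"
  have inj: "inj_on (\<lambda>b. [:b:]) B" by (auto intro: inj_onI)
  have "\<exists>x\<in>I. \<forall>p\<in>?B. p - x * p \<in> K"
  proof (rule nakayama)
    show "finite ?B" using assms(1) by simp
    show "0 \<in> I" by (simp add: I_def R0)
    show "x + y \<in> I" "x - y \<in> I" if "x \<in> I" "y \<in> I" for x y
      using that by (auto simp: I_def Radd Rdiff)
    show "x * y \<in> I" if "x \<in> I" "y \<in> I" for x y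
      using that by (auto simp: I_def coeff_mult intro!: Rsum Rmult)
    show "x + y \<in> K" "x - y \<in> K" if "x \<in> K" "y \<in> K" for x y
      using that unfolding K_def by (auto simp flip: distrib_left right_diff_distrib)
    show "x * y \<in> K" if "x \<in> I" "y \<in> K" for x y
      using that(2) unfolding K_def by (auto simp: mult.left_commute)
    fix p assume "p \<in> ?B"
    then obtain b where b: "p = [:b:]" "b \<in> B" by blast
    obtain y where y: "\<forall>b\<in>B. \<forall>k. coeff (y b) k \<in> R" "f * [:b:] = (\<Sum>b\<in>B. y b * [:b:])"
      using expand by blast
    define e where "e = scale (- 1 / \<nu>) (1 :: 'a)"
    define c where "c p' = pCons 0 (smult e (y (coeff p' 0)))" for p'
    have sum: "(\<Sum>b'\<in>?B. c b' * b') = (\<Sum>b'\<in>B. pCons 0 (smult e (y b')) * [:b':])"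
      by (simp add: sum.reindex[OF inj] c_def del: mult_pCons_left mult_pCons_right)
    have "p - (\<Sum>b'\<in>?B. c b' * b') = F * [:scale (1 / \<nu>) b:]"
    proof (rule poly_eqI)
      fix k
      have fb: "coeff f i * b = (\<Sum>b'\<in>B. coeff (y b') i * b')" for i
        using arg_cong[OF y(2), of "\<lambda>u. coeff u i"] by (simp only: coeff_mult_const coeff_sum)
      have eb: "(\<Sum>b'\<in>B. e * coeff (y b') i * b') = scale (- 1 / \<nu>) (coeff f i * b)" for i
        unfolding fb by (simp add: e_def scale_mult_left sum_distrib_left mult.assoc scale_sum_right)
      show "coeff (p - (\<Sum>b'\<in>?B. c b' * b')) k = coeff (F * [:scale (1 / \<nu>) b:]) k"
      proof (cases k)
        case 0
        then show ?thesis unfolding sum F_def b(1) using assms(3)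
          by (simp add: coeff_sum coeff_mult_const scale_mult_left scale_mult_right
              del: mult_pCons_left mult_pCons_right)
      next
        case (Suc i)
        have "coeff (p - (\<Sum>b'\<in>?B. c b' * b')) k = - scale (- 1 / \<nu>) (coeff f i * b)"
          unfolding sum b(1) Suc
          by (simp add: coeff_sum coeff_mult_const eb del: mult_pCons_left mult_pCons_right)
        also have "\<dots> = coeff (F * [:scale (1 / \<nu>) b:]) k"
          unfolding F_def Suc
          by (simp add: coeff_mult_const scale_mult_right del: mult_pCons_left mult_pCons_right)
        finally show ?thesis .
      qed
    qed
    then have "p - (\<Sum>b'\<in>?B. c b' * b') \<in> K" unfolding K_def by blast
    moreover have "\<forall>b'\<in>?B. c b' \<in> I"
    proof clarify
      fix b' assume "b' \<in> B"
      then have "e * coeff (y b') k \<in> R" for k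
        using y(1) unfolding e_def by (intro Rmult Rscale) blast
      then show "c [:b':] \<in> I"
        by (simp add: c_def I_def coeff_pCons R0 split: nat.split)
    qed
    ultimately show "\<exists>c. (\<forall>b'\<in>?B. c b' \<in> I) \<and> p - (\<Sum>b'\<in>?B. c b' * b') \<in> K" by blast
  qed
  then obtain x where x: "x \<in> I" "\<And>b. b \<in> B \<Longrightarrow> [:b:] - x * [:b:] \<in> K" by blast
  then have "\<forall>b\<in>B. \<exists>g. [:b:] - x * [:b:] = F * g" unfolding K_def by blast
  then obtain g where g: "\<And>b. b \<in> B \<Longrightarrow> [:b:] - x * [:b:] = F * g b" by metis
  obtain r where r: "1 = (\<Sum>b\<in>B. scale (r b) b)" using comb by blast
  have "[:1:] - x = (\<Sum>b\<in>B. smult (scale (r b) 1) ([:b:] - x * [:b:]))"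
  proof (rule poly_eqI)
    fix k
    have "(\<Sum>b\<in>B. scale (r b) (coeff x k * b)) = coeff x k * (\<Sum>b\<in>B. scale (r b) b)"
      by (simp add: sum_distrib_left scale_mult_right)
    also have "\<dots> = coeff x k" by (simp flip: r)
    finally have s: "(\<Sum>b\<in>B. scale (r b) (coeff x k * b)) = coeff x k" .
    show "coeff ([:1:] - x) k = coeff (\<Sum>b\<in>B. smult (scale (r b) 1) ([:b:] - x * [:b:])) k"
      using s r
      by (cases k) (simp_all add: coeff_sum scale_mult_left scale_right_diff_distrib
          sum_subtractf mult.commute[of _ "coeff x _"] sum_negf)
  qed
  also have "\<dots> = F * (\<Sum>b\<in>B. smult (scale (r b) 1) (g b))"
    using g by (simp add: sum_distrib_left)
  finally have Fg: "F * (\<Sum>b\<in>B. smult (scale (r b) 1) (g b)) = [:1:] - x" by simp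
  have "\<forall>k. \<exists>q. coeff x k = scale q 1" using x(1) unfolding I_def R_def by auto
  then obtain q where q: "\<And>k. coeff x k = scale (q k) 1" by metis
  define q' where "q' k = (if k = 0 then 1 else - q k)" for k
  have "coeff ([:1:] - x) k = scale (q' k) 1" for k
    using q[of k] x(1) by (cases k) (auto simp: q'_def I_def)
  then have "q' 0 = 1 \<and> (\<forall>k. coeff (F * (\<Sum>b\<in>B. smult (scale (r b) 1) (g b))) k = scale (q' k) 1)"
    unfolding Fg by (simp add: q'_def)
  then show ?thesis unfolding F_def by blast
qed

lemma multiple_of_unit_content:
  assumes "finite B" "span B = UNIV" "\<nu> \<noteq> 0"
  shows "\<exists>g. content_module (pCons (scale \<nu> 1) f * g) = Z.span {1}"
proof -
  define F where "F = pCons (scale \<nu> 1) f"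
  obtain g q where q: "q 0 = 1" "\<And>k. coeff (F * g) k = scale (q k) 1"
    using rational_multiple[OF assms] unfolding F_def by metis
  define S where "S = q ` {..degree (F * g)}"
  have finS: "finite S" by (simp add: S_def)
  obtain c u where c: "c = (\<Sum>x\<in>S. of_int (u x) * x)" "\<forall>x\<in>S. \<exists>z. x = of_int z * c"
    using finite_rat_subgroup_cyclic[OF finS] by (elim exE conjE)
  have "q 0 \<in> S" unfolding S_def by blast
  then have c0: "c \<noteq> 0" using c(2) q(1) by auto
  define g' where "g' = smult (scale (1 / c) 1) g"
  have coeff: "coeff (F * g') k = scale (q k / c) 1" for k
    unfolding g'_def by (simp add: q scale_mult_left)
  have "content_module (F * g') \<subseteq> Z.span {1}"
  proof (rule content_least[OF Z.subspace_span])
    fix k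
    show "coeff (F * g') k \<in> Z.span {1}"
    proof (cases "k \<le> degree (F * g)")
      case True
      then have "q k \<in> S" unfolding S_def by blast
      then obtain z where "q k = of_int z * c" using c(2) by blast
      then have "coeff (F * g') k = int_scale scale z 1"
        using c0 by (simp add: coeff int_scale_def)
      then show ?thesis by (simp add: Z.span_scale Z.span_base)
    next
      case False
      then have "coeff (F * g') k = 0"
        unfolding g'_def using coeff_eq_0[of "F * g" k] by simp
      then show ?thesis by (simp add: Z.span_zero)
    qed
  qed
  moreover have "1 \<in> content_module (F * g')"
  proof -
    have "1 = scale ((\<Sum>x\<in>S. of_int (u x) * x) / c) 1"
      unfolding c(1)[symmetric] using c0 by simp
    also have "\<dots> = (\<Sum>x\<in>S. int_scale scale (u x) (scale (x / c) 1))"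
      by (simp add: sum_divide_distrib scale_sum_left int_scale_def)
    also have "\<dots> \<in> content_module (F * g')"
    proof (intro Z.subspace_sum subspace_content Z.subspace_scale)
      fix x assume "x \<in> S"
      then obtain k where "x = q k" unfolding S_def by blast
      then show "scale (x / c) 1 \<in> content_module (F * g')"
        using coeff_in_content[of "F * g'" k] by (simp only: coeff)
    qed
    finally show ?thesis .
  qed
  ultimately have "content_module (F * g') = Z.span {1}"
    using Z.span_minimal[of "{1}" "content_module (F * g')"] by auto
  then show ?thesis unfolding F_def by blast
qed

section \<open>An invertible power of the lattice\<close>

lemma int_multiple_in_subgroup:
  assumes L: "Z.subspace L" and "x \<in> span L"
  shows "\<exists>n::int. n \<noteq> 0 \<and> scale (of_int n) x \<in> L"
  using assms(2)
proof (induction rule: span_induct_alt)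
  case base
  show ?case using L by (intro exI[of _ 1]) (simp add: Z.subspace_0)
next
  case (step q x y)
  obtain n where n: "n \<noteq> 0" "scale (of_int n) y \<in> L" using step by blast
  obtain a p where q: "q = of_int a / of_int p" "p > 0"
    using quotient_of_div[OF prod.collapse[symmetric]] quotient_of_denom_pos' by metis
  have "scale (of_int (n * p)) (scale q x + y)
      = int_scale scale (n * a) x + int_scale scale p (scale (of_int n) y)"
    using q by (simp add: int_scale_def scale_right_distrib mult.commute)
  also have "\<dots> \<in> L" using L n step by (intro Z.subspace_add Z.subspace_scale)
  finally show ?case using n q by (intro exI[of _ "n * p"]) simp
qed

lemma finitely_generated_prod:
  assumes "finite B" "Z.span B = P" "finite C" "Z.span C = Q"
  shows "\<exists>D. finite D \<and> Z.span D = P \<odot> Q"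
proof (intro exI conjI)
  have "{b * c | b c. b \<in> B \<and> c \<in> C} = (\<lambda>(b, c). b * c) ` (B \<times> C)" by auto
  then show "finite {b * c | b c. b \<in> B \<and> c \<in> C}" using assms by simp
  have "P \<odot> Q = B \<odot> C" using assms prod_span by metis
  then show "Z.span {b * c | b c. b \<in> B \<and> c \<in> C} = P \<odot> Q" by (simp add: prod_module_def)
qed

lemma finitely_generated_power:
  assumes "\<exists>B. finite B \<and> Z.span B = P"
  shows "\<exists>B. finite B \<and> Z.span B = power_module P k"
proof (induction k)
  case 0
  show ?case by (intro exI[of _ "{1}"]) simp
next
  case (Suc k)
  then show ?case using assms finitely_generated_prod[of _ P _ "power_module P k"] by auto
qed

lemma finitely_generated_content: "\<exists>B. finite B \<and> Z.span B = content_module f"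
proof -
  have "finite (range (coeff f))"
  proof (rule finite_subset)
    show "range (coeff f) \<subseteq> insert 0 (coeff f ` {..degree f})"
      using coeff_eq_0[of f] by (metis (no_types, lifting) UNIV_I atMost_iff image_eqI image_subsetI
          insertI1 insertI2 not_le)
  qed simp
  then show ?thesis unfolding content_module_def by blast
qed

lemma subspace_span_rat: "Z.subspace (span V)"
  by (rule Z.subspaceI) (simp_all add: span_zero span_add span_scale int_scale_def)

text \<open>
  The exponents are written with \<open>Suc\<close> because the final argument splits a factor \<open>L\<close> off \<open>L^(l+1)\<close>.
\<close>

lemma full_lattice_power_absorbs:
  assumes "full_lattice scale L"
  shows "\<exists>M l. (\<exists>B. finite B \<and> Z.span B = M) \<and>
    power_module L (Suc (Suc l)) \<odot> M = power_module L (Suc l)"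
proof -
  obtain B where L: "Z.subspace L" "finite B" "B \<subseteq> L" "Z.span B = L" "span L = UNIV"
    using assms unfolding full_lattice_def by blast
  have "span B = UNIV"
  proof -
    have "L \<subseteq> span B"
      unfolding L(4)[symmetric] by (rule Z.span_minimal[OF span_superset subspace_span_rat])
    then show ?thesis using L(5) span_minimal[OF _ subspace_span] by blast
  qed
  obtain n :: int where n: "n \<noteq> 0" "scale (of_int n) 1 \<in> L"
    using int_multiple_in_subgroup[OF L(1)] L(5) by (metis UNIV_I)
  obtain bs where bs: "set bs = B" using L(2) finite_list by blast
  define f where "f = pCons (scale (of_int n) 1) (Poly bs)"
  have "content_module f = L"
  proof
    have c: "coeff (Poly bs) i \<in> L" for i
      using bs L by (auto simp: nth_default_def Z.subspace_0)
    show "content_module f \<subseteq> L"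
      using c n L(1) by (intro content_least) (auto simp: f_def coeff_pCons split: nat.split)
    have "B \<subseteq> content_module f"
    proof
      fix b assume "b \<in> B"
      then obtain i where "i < length bs" "bs ! i = b" using bs by (metis in_set_conv_nth)
      then have "coeff f (Suc i) = b" by (simp add: f_def nth_default_def)
      then show "b \<in> content_module f" by (metis coeff_in_content)
    qed
    then show "L \<subseteq> content_module f"
      unfolding L(4)[symmetric] by (intro Z.span_minimal) simp_all
  qed
  obtain g where g: "content_module (f * g) = Z.span {1}"
    using multiple_of_unit_content[OF L(2) \<open>span B = UNIV\<close>] n(1) unfolding f_def
    by (metis of_int_eq_0_iff)
  define M where "M = content_module g"
  define l where "l = degree g"
  let ?P = "power_module L"
  have "?P (Suc (Suc l)) \<odot> M \<subseteq> ?P (Suc l) \<odot> Z.span {1}"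
    using dedekind_mertens[of "Suc l" g f] coeff_eq_0[of g]
    unfolding g M_def l_def \<open>content_module f = L\<close> by simp
  moreover have "?P (Suc l) \<odot> Z.span {1} = ?P (Suc l)"
    using prod_one[OF subspace_power] prod_commute by metis
  moreover have "?P (Suc l) \<subseteq> ?P (Suc (Suc l)) \<odot> M"
  proof -
    have "?P (Suc l) = ?P (Suc l) \<odot> content_module (f * g)"
      using g prod_one[OF subspace_power] prod_commute by metis
    also have "\<dots> \<subseteq> ?P (Suc l) \<odot> (L \<odot> M)"
      using content_mult[of f g] unfolding M_def \<open>content_module f = L\<close>
      by (intro prod_module_mono) auto
    also have "\<dots> = ?P (Suc (Suc l)) \<odot> M" by (simp add: prod_ac)
    finally show ?thesis .
  qed
  ultimately have "?P (Suc (Suc l)) \<odot> M = ?P (Suc l)" by blast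
  moreover have "\<exists>B. finite B \<and> Z.span B = M"
    unfolding M_def by (rule finitely_generated_content)
  ultimately show ?thesis by blast
qed

lemma span_prod_absorbs:
  assumes "span P = UNIV" "q \<in> Q"
  shows "a * q \<in> span (P \<odot> Q)"
proof -
  have "a \<in> span P" using assms by simp
  then show ?thesis
  proof (induction rule: span_induct_alt)
    case base then show ?case by (simp add: span_zero)
  next
    case (step c p y)
    have "p * q \<in> span (P \<odot> Q)" using step assms(2) by (intro span_base prodI)
    then show ?case using step
      by (simp add: distrib_right scale_mult_left span_add span_scale)
  qed
qed

lemma span_prod_both:
  assumes "span P = UNIV" "span Q = UNIV"
  shows "span (P \<odot> Q) = UNIV"
proof -
  have "y \<in> span (P \<odot> Q)" if "y \<in> span Q" for y
    using that
  proof (induction rule: span_induct_alt)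
    case base then show ?case by (simp add: span_zero)
  next
    case (step c q y)
    have "1 * q \<in> span (P \<odot> Q)" using step(1) by (intro span_prod_absorbs assms(1))
    then show ?case using step by (simp add: span_add span_scale)
  qed
  then show ?thesis using assms by auto
qed

text \<open>
  The rational span of \<open>P \<odot> Q\<close> is an ideal, and it contains \<open>P \<odot> Q \<odot> R\<close>, hence \<open>1\<close>. This
  yields fullness of products with powers of \<open>M\<close>, which itself may span a proper subspace.
\<close>

lemma span_prod_UNIV:
  assumes "span P = UNIV" "1 \<in> (P \<odot> Q) \<odot> R"
  shows "span (P \<odot> Q) = UNIV"
proof -
  let ?T = "{x. \<forall>a\<in>UNIV. x * a \<in> span (P \<odot> Q)}"
  have T: "Z.subspace ?T" by (rule subspace_residual[OF subspace_span_rat])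
  have "P \<odot> Q \<subseteq> ?T"
  proof (rule prod_least[OF T])
    fix p q assume "q \<in> Q"
    then have "(a * p) * q \<in> span (P \<odot> Q)" for a by (intro span_prod_absorbs assms)
    then show "p * q \<in> ?T" by (simp add: mult_ac)
  qed
  then have "(P \<odot> Q) \<odot> R \<subseteq> ?T"
    by (intro prod_least[OF T]) (auto simp: mult.assoc)
  then have "1 * a \<in> span (P \<odot> Q)" for a using assms(2) by blast
  then show ?thesis by auto
qed

section \<open>Idempotent modules are orders\<close>

lemma prod_finite_combination:
  assumes "Z.subspace E" "finite B" "x \<in> E \<odot> B"
  shows "\<exists>c. (\<forall>b\<in>B. c b \<in> E) \<and> x = (\<Sum>b\<in>B. c b * b)"
proof -
  let ?T = "{x. \<exists>c. (\<forall>b\<in>B. c b \<in> E) \<and> x = (\<Sum>b\<in>B. c b * b)}"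
  have "E \<odot> B \<subseteq> ?T"
  proof (rule prod_least)
    show "Z.subspace ?T"
    proof (rule Z.subspaceI)
      show "0 \<in> ?T"
        using assms(1) by (intro CollectI exI[of _ "\<lambda>_. 0"]) (simp add: Z.subspace_0)
    next
      fix x y assume "x \<in> ?T" "y \<in> ?T"
      then obtain c d where "\<forall>b\<in>B. c b \<in> E" "x = (\<Sum>b\<in>B. c b * b)"
        "\<forall>b\<in>B. d b \<in> E" "y = (\<Sum>b\<in>B. d b * b)" by blast
      then show "x + y \<in> ?T"
        using assms(1) by (intro CollectI exI[of _ "\<lambda>b. c b + d b"])
          (simp add: Z.subspace_add distrib_right sum.distrib)
    next
      fix n x assume "x \<in> ?T"
      then obtain c where "\<forall>b\<in>B. c b \<in> E" "x = (\<Sum>b\<in>B. c b * b)" by blast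
      then show "int_scale scale n x \<in> ?T"
        using assms(1) by (intro CollectI exI[of _ "\<lambda>b. int_scale scale n (c b)"])
          (simp add: Z.subspace_scale int_scale_mult_left Z.scale_sum_right)
    qed
    fix p q assume "p \<in> E" "q \<in> B"
    moreover have "(\<Sum>b\<in>B. (if b = q then p else 0) * b) = (\<Sum>b\<in>B. if b = q then p * b else 0)"
      by (rule sum.cong) auto
    ultimately show "p * q \<in> ?T"
      using assms(1,2)
      by (intro CollectI exI[of _ "\<lambda>b. if b = q then p else 0"]) (auto simp: Z.subspace_0)
  qed
  then show ?thesis using assms(3) by blast
qed

text \<open>
  Nakayama's lemma gives \<open>x \<in> E\<close> such that \<open>1 - x\<close> annihilates \<open>P\<close>, and therefore its span \<open>A\<close>.
\<close>

lemma idempotent_contains_one: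
  assumes "Z.subspace E" "E \<odot> E = E" "E \<odot> P = P"
    and "finite B" "Z.span B = P" "span P = UNIV"
  shows "1 \<in> E"
proof -
  have "\<exists>x\<in>E. \<forall>b\<in>B. b - x * b \<in> {0}"
  proof (rule nakayama)
    show "finite B" by (rule assms)
    show "0 \<in> E" "\<And>x y. x \<in> E \<Longrightarrow> y \<in> E \<Longrightarrow> x + y \<in> E" "\<And>x y. x \<in> E \<Longrightarrow> y \<in> E \<Longrightarrow> x - y \<in> E"
      using assms(1) by (simp_all add: Z.subspace_0 Z.subspace_add Z.subspace_diff)
    show "x * y \<in> E" if "x \<in> E" "y \<in> E" for x y
      using prodI[OF that] assms(2) by simp
    fix b assume "b \<in> B"
    then have "b \<in> E \<odot> B"
      using assms(3,5) prod_span_right[of E B] Z.span_base by auto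
    from prod_finite_combination[OF assms(1,4) this]
    show "\<exists>c. (\<forall>b'\<in>B. c b' \<in> E) \<and> b - (\<Sum>b'\<in>B. c b' * b') \<in> {0}" by auto
  qed auto
  then obtain x where x: "x \<in> E" "\<forall>b\<in>B. b = x * b" by auto
  have "B \<subseteq> {y. \<forall>q\<in>{1 - x}. y * q \<in> {0}}"
    using x(2) by (auto simp: right_diff_distrib mult.commute)
  then have "P \<subseteq> {y. \<forall>q\<in>{1 - x}. y * q \<in> {0}}"
    unfolding assms(5)[symmetric]
    by (intro Z.span_minimal subspace_residual Z.subspace_single_0)
  then have P: "y * (1 - x) = 0" if "y \<in> P" for y using that by auto
  have "y * (1 - x) = 0" if "y \<in> span P" for y
    using that by (induction rule: span_induct_alt) (simp_all add: P distrib_right scale_mult_left)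
  from this[of 1] have "1 * (1 - x) = 0" using assms(6) by simp
  then show ?thesis using x(1) by simp
qed

lemma full_latticeI:
  assumes "finite B" "Z.span B = P" "span P = UNIV"
  shows "full_lattice scale P"
  using assms Z.span_superset[of B] unfolding full_lattice_def by auto

text \<open>
  Here \<open>E = L^k M^k\<close> is the order and \<open>E N\<close> the inverse of \<open>E L\<close>, where \<open>N = L^(k-1) M^k\<close>.
\<close>

lemma full_lattice_invertible_over_order:
  assumes L: "full_lattice scale L"
  shows "\<exists>\<Lambda>. is_order scale \<Lambda> \<and> order_of L \<subseteq> \<Lambda> \<and> lattice_mult \<Lambda> L \<in> G scale \<Lambda>"
proof -
  have subL: "Z.subspace L" and fgL: "\<exists>B. finite B \<and> Z.span B = L" and spL: "span L = UNIV"
    using L unfolding full_lattice_def by auto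
  let ?P = "power_module L"
  obtain M l where fgM: "\<exists>B. finite B \<and> Z.span B = M"
    and M: "?P (Suc (Suc l)) \<odot> M = ?P (Suc l)"
    using full_lattice_power_absorbs[OF L] by blast
  define k where "k = Suc l"
  have spP: "span (?P (Suc n)) = UNIV" for n
  proof (induction n)
    case 0
    have "?P (Suc 0) = L" using prod_one[OF subL] by (simp add: prod_commute)
    then show ?case using spL by simp
  next
    case (Suc n)
    then show ?case unfolding power_module.simps(2)[of L "Suc n"] by (intro span_prod_both spL)
  qed
  have absorb: "power_module (L \<odot> M) n \<odot> ?P k = ?P k" for n
  proof (induction n)
    case 0
    show ?case by (simp add: prod_one)
  next
    case (Suc n)
    have "power_module (L \<odot> M) (Suc n) \<odot> ?P k = power_module (L \<odot> M) n \<odot> (?P (Suc k) \<odot> M)"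
      by (simp add: prod_ac)
    also have "\<dots> = ?P k" using M Suc unfolding k_def by simp
    finally show ?case .
  qed
  have LM: "power_module (L \<odot> M) n = ?P n \<odot> power_module M n" for n
    by (induction n) (simp_all add: prod_ac prod_one)
  define E where "E = power_module (L \<odot> M) k"
  define N where "N = ?P l \<odot> power_module M k"
  have subE: "Z.subspace E" by (simp add: E_def)
  have EP: "E \<odot> ?P k = ?P k" unfolding E_def by (rule absorb)
  have EE: "E \<odot> E = E"
    using EP by (simp add: E_def LM flip: prod_assoc)
  have LN: "L \<odot> N = E" unfolding E_def N_def LM by (simp add: k_def prod_assoc)
  obtain B where B: "finite B" "Z.span B = ?P k" using finitely_generated_power[OF fgL] by blast
  have E1: "1 \<in> E"
    using idempotent_contains_one[OF subE EE EP B] spP unfolding k_def by blast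
  have fg: "\<exists>B. finite B \<and> Z.span B = P \<odot> Q"
    if "\<exists>B. finite B \<and> Z.span B = P" "\<exists>B. finite B \<and> Z.span B = Q" for P Q
    using that finitely_generated_prod by metis
  have fgE: "\<exists>B. finite B \<and> Z.span B = E"
    unfolding E_def by (intro finitely_generated_power fg fgL fgM)
  have fgN: "\<exists>B. finite B \<and> Z.span B = N"
    unfolding N_def by (intro finitely_generated_power fg fgL fgM)
  have E_eq: "E = ?P k \<odot> power_module M k" unfolding E_def by (rule LM)
  have spE: "span E = UNIV"
    unfolding E_eq
  proof (rule span_prod_UNIV)
    show "span (?P k) = UNIV" unfolding k_def by (rule spP)
    show "1 \<in> ?P k \<odot> power_module M k \<odot> E" unfolding E_eq[symmetric] EE by (rule E1)
  qed
  have fullE: "full_lattice scale E" using fgE spE full_latticeI by blast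
  have fullEL: "full_lattice scale (E \<odot> L)"
    using fg[OF fgE fgL] span_prod_both[OF spE spL] full_latticeI by blast
  have ELN: "E \<odot> L \<odot> (E \<odot> N) = E"
  proof -
    have "E \<odot> L \<odot> (E \<odot> N) = E \<odot> E \<odot> (L \<odot> N)" by (simp add: prod_ac)
    then show ?thesis using LN EE by simp
  qed
  have fullEN: "full_lattice scale (E \<odot> N)"
  proof -
    have "E \<odot> N \<odot> (E \<odot> L) = E" using ELN by (simp only: prod_commute)
    then have "span (E \<odot> N) = UNIV" using E1 by (intro span_prod_UNIV[OF spE, of N "E \<odot> L"]) simp
    then show ?thesis using fg[OF fgE fgN] full_latticeI by blast
  qed
  have ELE: "E \<odot> L \<odot> E = E \<odot> L" using EE by (metis prod_assoc prod_commute)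
  have stab: "a * x \<in> V \<odot> W" if "\<And>v. v \<in> V \<Longrightarrow> a * v \<in> V" "x \<in> V \<odot> W" for a x V W
  proof -
    have "V \<odot> W \<subseteq> {x. \<forall>q\<in>{a}. x * q \<in> V \<odot> W}"
    proof (rule prod_least[OF subspace_residual[OF subspace_prod]])
      fix v w assume "v \<in> V" "w \<in> W"
      then have "(a * v) * w \<in> V \<odot> W" using that(1) by (intro prodI)
      then show "v * w \<in> {x. \<forall>q\<in>{a}. x * q \<in> V \<odot> W}" by (simp add: mult_ac)
    qed
    then show ?thesis using that(2) by (auto simp: mult.commute)
  qed
  \<comment> \<open>A multiplier of a factor of \<open>E\<close> is a multiplier of \<open>E\<close>, and \<open>1 \<in> E\<close>.\<close>
  have order_leE: "order_of V \<subseteq> E" if "V \<odot> W = E" for V W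
  proof
    fix a assume "a \<in> order_of V"
    then have "a * 1 \<in> V \<odot> W" using E1 that by (intro stab) (auto simp: order_of_def)
    then show "a \<in> E" using that by simp
  qed
  have "order_of (E \<odot> L) = E"
  proof
    show "order_of (E \<odot> L) \<subseteq> E" by (rule order_leE[OF ELN])
    have "a * x \<in> E \<odot> L" if "a \<in> E" "x \<in> E \<odot> L" for a x
      using that EE prodI[of a E] by (intro stab) auto
    then show "E \<subseteq> order_of (E \<odot> L)" by (auto simp: order_of_def)
  qed
  moreover have "invertible_lattice scale (E \<odot> L)"
    unfolding invertible_lattice_def
    using fullEL fullEN fullE ELN ELE
    by (intro conjI exI[of _ "E \<odot> N"] exI[of _ E]) (simp_all add: lattice_mult_eq_prod)
  ultimately have "lattice_mult E L \<in> G scale E"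
    unfolding G_def by (simp add: lattice_mult_eq_prod subE)
  moreover have "is_order scale E"
    unfolding is_order_def using fullE E1 EE by (simp add: lattice_mult_eq_prod subE)
  ultimately show ?thesis using order_leE[OF LN] by blast
qed

end

theorem theorem10p2:
  fixes scale :: "rat \<Rightarrow> 'a::{comm_ring, comm_monoid_mult} \<Rightarrow> 'a"
    and L :: "'a set"
  assumes "fin_dim_comm_rat_algebra scale"
    and "full_lattice scale L"
  shows "\<exists>\<Lambda>. is_order scale \<Lambda> \<and> order_of L \<subseteq> \<Lambda> \<and> lattice_mult \<Lambda> L \<in> G scale \<Lambda>"
  using fin_dim_comm_rat_algebra.full_lattice_invertible_over_order[OF assms] .

end
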